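(* Let $d \geq 2$ and let $m_1 \leq m_2 \leq \dots \leq m_d$ be natural numbers. (1) If $d=2$, then $cub(TCC(m_1,m_2)) \geq box(TCC(m_1,m_2)) \geq m_1$. (2) If $d\geq 3$, then $cub(TCC(m_1,\dots,m_d)) \geq box(TCC(m_1,\dots,m_d))$, and $$box(TCC(m_1,\dots,m_d)) \geq (m_1+m_3+\dots+m_{d-2})+m_{d-1} \quad\text{when } d \text{ is odd},$$ $$box(TCC(m_1,\dots,m_d)) \geq (m_2+m_4+\dots+m_{d-2})+m_{d-1} \quad\text{when } d \text{ is even}.$$ Here the sum in parentheses runs over all odd indices from $1$ to $d-2$ when $d$ is odd, and over all even indices from $2$ to $d-2$ when $d$ is even.
   Context: Natural numbers here are positive integers. All graphs are finite, simple and undirected. Boxicity and cubicity: a $k$-box (resp. $k$-cube) is a Cartesian product of $k$ closed intervals (resp. closed unit-length intervals) of $\mathbb{R}$. A $k$-box (resp. $k$-cube) representation of a graph $\Gamma$ is a function $f$ assigning to each vertex a $k$-box (resp. $k$-cube) such that two distinct vertices $u,v$ are adjacent if and only if $f(u)\cap f(v)\neq\emptyset$. The boxicity $box(\Gamma)$ (resp. cubicity $cub(\Gamma)$) is the smallest non-negative integer $k$ for which $\Gamma$ has a $k$-box (resp. $k$-cube) representation; complete graphs have boxicity and cubicity $0$. For positive integers $a_1,\dots,a_s$, $TCC(a_1,\dots,a_s)$ (the transitive closure of the Cartesian product of the complete graphs $K_{a_1+1},\dots,K_{a_s+1}$) is the graph whose vertices are the integer $s$-tuples $x=(x_1,\dots,x_s)$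 with $0\leq x_i\leq a_i$ for all $i$, where two distinct vertices $x,y$ are adjacent if and only if either $x_i\leq y_i$ for all $i$, or $x_i\geq y_i$ for all $i$. *)

theory Defs
  imports Complex_Main "HOL-Library.FuncSet" "Graph_Theory.Pair_Digraph"
begin

text \<open>
  Finite simple undirected graphs are the symmetric loop-free digraphs of locale
  \<^locale>\<open>pair_graph\<close>: two vertices are adjacent iff the pair of them is an arc.

  Points of $k$-dimensional space are the extensional functions on the index set
  \<open>{..<k}\<close>. Closed intervals are bounded and nonempty (possibly a single point).
  For \<open>k = 0\<close> the only box is the one-point space, so exactly the complete graphs have
  a \<open>0\<close>-box representation.
\<close>

definition is_box :: "nat \<Rightarrow> (nat \<Rightarrow> real) set \<Rightarrow> bool" where
  "is_box k B \<longleftrightarrow>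
     (\<exists>I :: nat \<Rightarrow> real set. (\<forall>i<k. \<exists>a b. a \<le> b \<and> I i = {a..b}) \<and> B = (\<Pi>\<^sub>E i\<in>{..<k}. I i))"

definition is_cube :: "nat \<Rightarrow> (nat \<Rightarrow> real) set \<Rightarrow> bool" where
  "is_cube k B \<longleftrightarrow>
     (\<exists>I :: nat \<Rightarrow> real set. (\<forall>i<k. \<exists>a. I i = {a..a + 1}) \<and> B = (\<Pi>\<^sub>E i\<in>{..<k}. I i))"

definition intersection_rep :: "'v pair_pre_digraph \<Rightarrow> ('v \<Rightarrow> 'p set) \<Rightarrow> bool" where
  "intersection_rep G f \<longleftrightarrow>
     (\<forall>u\<in>pverts G. \<forall>v\<in>pverts G. u \<noteq> v \<longrightarrow> ((u, v) \<in> parcs G \<longleftrightarrow> f u \<inter> f v \<noteq> {}))"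

definition box_rep :: "nat \<Rightarrow> 'v pair_pre_digraph \<Rightarrow> ('v \<Rightarrow> (nat \<Rightarrow> real) set) \<Rightarrow> bool" where
  "box_rep k G f \<longleftrightarrow> (\<forall>v\<in>pverts G. is_box k (f v)) \<and> intersection_rep G f"

definition cube_rep :: "nat \<Rightarrow> 'v pair_pre_digraph \<Rightarrow> ('v \<Rightarrow> (nat \<Rightarrow> real) set) \<Rightarrow> bool" where
  "cube_rep k G f \<longleftrightarrow> (\<forall>v\<in>pverts G. is_cube k (f v)) \<and> intersection_rep G f"

text \<open>
  The minima below exist for every \<^locale>\<open>pair_graph\<close>; see \<open>box_rep_exists\<close> and
  \<open>cube_rep_exists\<close>.
\<close>

definition boxicity :: "'v pair_pre_digraph \<Rightarrow> nat" where
  "boxicity G = (LEAST k. \<exists>f. box_rep k G f)"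

definition cubicity :: "'v pair_pre_digraph \<Rightarrow> nat" where
  "cubicity G = (LEAST k. \<exists>f. cube_rep k G f)"

text \<open>
  \<open>TCC s a\<close> is $TCC(a_1,\dots,a_s)$; an $s$-tuple is an extensional function on
  \<open>{1..s}\<close>, and only the values of \<open>a\<close> on \<open>{1..s}\<close> matter.
\<close>

definition TCC :: "nat \<Rightarrow> (nat \<Rightarrow> nat) \<Rightarrow> (nat \<Rightarrow> nat) pair_pre_digraph" where
  "TCC s a = (let V = (\<Pi>\<^sub>E i\<in>{1..s}. {0..a i}) in
     \<lparr> pverts = V,
       parcs = {(x, y). x \<in> V \<and> y \<in> V \<and> x \<noteq> y \<and>
                  ((\<forall>i\<in>{1..s}. x i \<le> y i) \<or> (\<forall>i\<in>{1..s}. x i \<ge> y i))} \<rparr>)"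

lemma pair_graph_TCC: "pair_graph (TCC s a)"
proof -
  have fin: "finite (pverts (TCC s a))"
    by (auto simp: TCC_def Let_def intro!: finite_PiE)
  moreover have sub: "parcs (TCC s a) \<subseteq> pverts (TCC s a) \<times> pverts (TCC s a)"
    by (auto simp: TCC_def Let_def)
  ultimately have "finite (parcs (TCC s a))"
    by (meson finite_SigmaI finite_subset)
  moreover have "sym (parcs (TCC s a))"
    by (auto simp: TCC_def Let_def sym_def)
  moreover have "fst e \<noteq> snd e" if "e \<in> parcs (TCC s a)" for e
    using that by (auto simp: TCC_def Let_def)
  ultimately show ?thesis
    using fin sub by unfold_locales (auto simp: symmetric_def)
qed

lemma is_cube_imp_is_box: "is_cube k B \<Longrightarrow> is_box k B"
  unfolding is_cube_def is_box_def by (metis add_increasing2 order_refl zero_le_one)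

lemma cube_rep_imp_box_rep: "cube_rep k G f \<Longrightarrow> box_rep k G f"
  unfolding cube_rep_def box_rep_def using is_cube_imp_is_box by blast

lemma cube_rep_exists:
  assumes "pair_graph G"
  shows "\<exists>k f. cube_rep k G f"
proof -
  interpret pair_graph G by fact
  let ?V = "pverts G" and ?E = "parcs G"
  define n where "n = card ?V"
  obtain h where h: "bij_betw h {0..<n} ?V"
    using ex_bij_betw_nat_finite[OF pair_finite_verts] unfolding n_def by blast
  define c :: "'a \<Rightarrow> nat \<Rightarrow> real" where
    "c v i = (if v = h i then 0 else if (h i, v) \<in> ?E then 1 else 2)" for v i
  define f where "f v = (\<Pi>\<^sub>E i\<in>{..<n}. {c v i..c v i + 1})" for v
  have E_sym: "(v, u) \<in> ?E" if "(u, v) \<in> ?E" for u v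
    using that pair_sym_arcs by (auto simp: symmetric_def sym_def)
  have "is_cube n (f v)" for v
    unfolding is_cube_def f_def by (intro exI[of _ "\<lambda>i. {c v i..c v i + 1}"]) auto
  moreover have "(u, v) \<in> ?E \<longleftrightarrow> f u \<inter> f v \<noteq> {}"
    if u: "u \<in> ?V" and v: "v \<in> ?V" and "u \<noteq> v" for u v
  proof -
    have "f u \<inter> f v \<noteq> {} \<longleftrightarrow> (\<forall>i<n. {c u i..c u i + 1} \<inter> {c v i..c v i + 1} \<noteq> {})"
      unfolding f_def PiE_Int PiE_eq_empty_iff by auto
    also have "\<dots> \<longleftrightarrow> (\<forall>i<n. \<bar>c u i - c v i\<bar> \<le> 1)"
      by (auto simp: Int_atLeastAtMost abs_le_iff)
    also have "\<dots> \<longleftrightarrow> (u, v) \<in> ?E"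
    proof
      assume *: "\<forall>i<n. \<bar>c u i - c v i\<bar> \<le> 1"
      have "u \<in> h ` {0..<n}"
        using h u by (simp add: bij_betw_def)
      then obtain i where "i < n" "h i = u"
        by auto
      then show "(u, v) \<in> ?E"
        using * \<open>u \<noteq> v\<close> by (force simp: c_def split: if_splits)
    next
      assume "(u, v) \<in> ?E"
      then show "\<forall>i<n. \<bar>c u i - c v i\<bar> \<le> 1"
        using E_sym \<open>u \<noteq> v\<close> by (auto simp: c_def)
    qed
    finally show ?thesis by simp
  qed
  ultimately show ?thesis
    unfolding cube_rep_def intersection_rep_def by blast
qed

lemma box_rep_exists:
  assumes "pair_graph G"
  shows "\<exists>k f. box_rep k G f"
  using cube_rep_exists[OF assms] cube_rep_imp_box_rep by blast

end

theory Submission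
  imports Defs
begin

text \<open>
  Fix a box representation, and for points \<open>a \<le> b\<close> let \<open>S(a,b)\<close> be the set of coordinates of
  space in which some two vertices of the order interval \<open>[a,b]\<close> are separated.  If \<open>a \<le> b \<le> c\<close>,
  every vertex of \<open>[a,b]\<close> is comparable to every vertex of \<open>[b,c]\<close>; since two pairs of disjoint real
  intervals cannot all meet across the pairs, \<open>S(a,b)\<close> and \<open>S(b,c)\<close> are disjoint, so \<open>|S|\<close> is
  superadditive.  A unit square contributes at least \<open>1\<close>, and a unit 3-cube at least \<open>2\<close>, because
  its six middle vertices induce a 6-cycle, which is not an interval graph.  Walking from \<open>0\<close> to
  \<open>m\<close> through squares in the coordinate pairs \<open>(1,2), (3,4), \<dots>\<close> and finally through cubes and
  squares in the last three coordinates gives the bound for odd \<open>d\<close>; for even \<open>d\<close> the first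
  coordinate is left unused.
\<close>

text \<open>\<open>l i x\<close> and \<open>r i x\<close> are the endpoints of side \<open>i\<close>
  of the box of \<open>x\<close>, so the argument only compares reals.\<close>

locale TCC_intervals =
  fixes d :: nat and m :: "nat \<Rightarrow> nat" and k :: nat
    and l r :: "nat \<Rightarrow> (nat \<Rightarrow> nat) \<Rightarrow> real"
  assumes nonempty: "\<lbrakk>x \<in> pverts (TCC d m); i < k\<rbrakk> \<Longrightarrow> l i x \<le> r i x"
    and adjacent_iff: "\<lbrakk>x \<in> pverts (TCC d m); y \<in> pverts (TCC d m); x \<noteq> y\<rbrakk> \<Longrightarrow>
      (x, y) \<in> parcs (TCC d m) \<longleftrightarrow> (\<forall>i<k. l i x \<le> r i y \<and> l i y \<le> r i x)"
begin

section \<open>Separating coordinates of an order interval\<close>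

definition order_interval :: "(nat \<Rightarrow> nat) \<Rightarrow> (nat \<Rightarrow> nat) \<Rightarrow> (nat \<Rightarrow> nat) set" where
  "order_interval a b = {x \<in> pverts (TCC d m). \<forall>i\<in>{1..d}. a i \<le> x i \<and> x i \<le> b i}"

text \<open>One inequality suffices: \<open>x\<close> and \<open>y\<close> range over the same set,
  so the mirrored case is included.\<close>

definition separating :: "(nat \<Rightarrow> nat) \<Rightarrow> (nat \<Rightarrow> nat) \<Rightarrow> nat set" where
  "separating a b = {i. i < k \<and> (\<exists>x\<in>order_interval a b. \<exists>y\<in>order_interval a b. r i x < l i y)}"

lemma finite_separating [simp]: "finite (separating a b)"
  unfolding separating_def by simp

lemma card_separating_le: "card (separating a b) \<le> k"
  using card_mono[of "{..<k}" "separating a b"] by (auto simp: separating_def)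

lemma separatingI:
  assumes "x \<in> order_interval a b" "y \<in> order_interval a b" "i < k" "r i x < l i y"
  shows "i \<in> separating a b"
  using assms unfolding separating_def by blast

lemma separating_mono:
  assumes "\<And>i. i \<in> {1..d} \<Longrightarrow> a' i \<le> a i" "\<And>i. i \<in> {1..d} \<Longrightarrow> b i \<le> b' i"
  shows "separating a b \<subseteq> separating a' b'"
proof -
  have "order_interval a b \<subseteq> order_interval a' b'"
    using assms unfolding order_interval_def by (blast intro: order_trans)
  then show ?thesis
    unfolding separating_def by blast
qed

lemma comparable_imp_meet:
  assumes "x \<in> pverts (TCC d m)" "y \<in> pverts (TCC d m)" "\<And>j. j \<in> {1..d} \<Longrightarrow> x j \<le> y j" "i < k"
  shows "l i x \<le> r i y" "l i y \<le> r i x"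
proof -
  have "l i x \<le> r i y \<and> l i y \<le> r i x"
  proof (cases "x = y")
    case False
    then have "(x, y) \<in> parcs (TCC d m)"
      using assms by (simp add: TCC_def Let_def)
    then show ?thesis
      using adjacent_iff False assms by blast
  qed (use assms nonempty in simp)
  then show "l i x \<le> r i y" "l i y \<le> r i x" by auto
qed

lemma incomparable_separated:
  assumes "x \<in> order_interval a b" "y \<in> order_interval a b"
    and "p \<in> {1..d}" "x p < y p" and "q \<in> {1..d}" "y q < x q"
  shows "\<exists>i\<in>separating a b. r i x < l i y \<or> r i y < l i x"
proof -
  have V: "x \<in> pverts (TCC d m)" "y \<in> pverts (TCC d m)"
    using assms by (auto simp: order_interval_def)
  have "\<not> (\<forall>i\<in>{1..d}. x i \<le> y i)" "\<not> (\<forall>i\<in>{1..d}. y i \<le> x i)" "x \<noteq> y"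
    using assms leD by blast+
  then have "(x, y) \<notin> parcs (TCC d m)"
    by (auto simp: TCC_def Let_def)
  then obtain i where "i < k" "r i x < l i y \<or> r i y < l i x"
    using adjacent_iff[OF V \<open>x \<noteq> y\<close>] by force
  then show ?thesis
    using separatingI assms(1,2) by blast
qed

lemma separating_disjoint: "separating a b \<inter> separating b c = {}"
proof (rule ccontr)
  assume "separating a b \<inter> separating b c \<noteq> {}"
  then obtain i x y z w where i: "i < k"
    and xy: "x \<in> order_interval a b" "y \<in> order_interval a b" "r i x < l i y"
    and zw: "z \<in> order_interval b c" "w \<in> order_interval b c" "r i z < l i w"
    unfolding separating_def by blast
  have le: "u j \<le> v j" if "u \<in> order_interval a b" "v \<in> order_interval b c" "j \<in> {1..d}" for u v j
    using that order_trans unfolding order_interval_def by blast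
  have V: "x \<in> pverts (TCC d m)" "y \<in> pverts (TCC d m)" "z \<in> pverts (TCC d m)" "w \<in> pverts (TCC d m)"
    using xy zw by (auto simp: order_interval_def)
  \<comment> \<open>Comparability across \<open>b\<close> closes the cycle
    \<open>r i x < l i y \<le> r i z < l i w \<le> r i x\<close>.\<close>
  have "l i w \<le> r i x"
    by (rule comparable_imp_meet(2)[OF V(1,4) le[OF xy(1) zw(2)] i])
  moreover have "l i y \<le> r i z"
    by (rule comparable_imp_meet(1)[OF V(2,3) le[OF xy(2) zw(1)] i])
  ultimately show False
    using xy zw by linarith
qed

lemma card_separating_superadditive:
  assumes "\<And>i. i \<in> {1..d} \<Longrightarrow> a i \<le> b i" "\<And>i. i \<in> {1..d} \<Longrightarrow> b i \<le> c i"
  shows "card (separating a b) + card (separating b c) \<le> card (separating a c)"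
proof -
  have "card (separating a b) + card (separating b c) = card (separating a b \<union> separating b c)"
    by (simp add: card_Un_disjoint separating_disjoint)
  also have "\<dots> \<le> card (separating a c)"
    using assms by (intro card_mono Un_least separating_mono) auto
  finally show ?thesis .
qed

text \<open>The corners \<open>a\<close>, \<open>b\<close> may be arbitrary functions, while
  vertices are extensional; restriction turns an updated corner into a vertex.\<close>

lemma order_interval_restrict:
  assumes "\<And>i. i \<in> {1..d} \<Longrightarrow> a i \<le> x i \<and> x i \<le> b i" "\<And>i. i \<in> {1..d} \<Longrightarrow> b i \<le> m i"
  shows "restrict x {1..d} \<in> order_interval a b"
  using assms order_trans by (fastforce simp: order_interval_def TCC_def Let_def)

section \<open>Unit squares and unit cubes\<close>

lemma card_separating_square:
  assumes le: "\<And>i. i \<in> {1..d} \<Longrightarrow> a i \<le> b i" "\<And>i. i \<in> {1..d} \<Longrightarrow> b i \<le> m i"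
    and pq: "p \<in> {1..d}" "q \<in> {1..d}" "p \<noteq> q" "a p < b p" "a q < b q"
  shows "1 \<le> card (separating a b)"
proof -
  \<comment> \<open>One step up from \<open>a\<close> in direction \<open>p\<close> and one in
    direction \<open>q\<close> give incomparable vertices.\<close>
  let ?x = "\<lambda>j. restrict (a(j := Suc (a j))) {1..d}"
  have "?x p \<in> order_interval a b" "?x q \<in> order_interval a b"
    by (rule order_interval_restrict; use assms in auto)+
  from incomparable_separated[OF this, of q p] show ?thesis
    using pq by (auto simp: Suc_le_eq card_gt_0_iff)
qed

lemma card_separating_cube:
  assumes le: "\<And>i. i \<in> {1..d} \<Longrightarrow> a i \<le> b i" "\<And>i. i \<in> {1..d} \<Longrightarrow> b i \<le> m i"
    and pqs: "p \<in> {1..d}" "q \<in> {1..d}" "s \<in> {1..d}" "p \<noteq> q" "p \<noteq> s" "q \<noteq> s"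
    and less: "a p < b p" "a q < b q" "a s < b s"
  shows "2 \<le> card (separating a b)"
proof (rule ccontr)
  assume "\<not> 2 \<le> card (separating a b)"
  moreover have "1 \<le> card (separating a b)"
    using card_separating_square assms by blast
  ultimately have "card (separating a b) = 1" by simp
  \<comment> \<open>Every incomparable pair between \<open>a\<close> and \<open>b\<close> must now
    be disjoint in the single coordinate \<open>i\<close>, so the sides in that coordinate would
    represent the 6-cycle.\<close>
  then obtain i where sep: "separating a b = {i}"
    by (auto simp: card_1_singleton_iff)
  then have "i < k"
    unfolding separating_def by blast
  \<comment> \<open>The two middle layers of the unit cube at \<open>a\<close> in directions
    \<open>p\<close>, \<open>q\<close>, \<open>s\<close>: a coatom lies above two atoms and is
    incomparable to the third.\<close>
  define atom where "atom j = restrict (a(j := Suc (a j))) {1..d}" for j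
  define coatom where "coatom j j' = restrict (a(j := Suc (a j), j' := Suc (a j'))) {1..d}" for j j'
  let ?T = "{p, q, s}"
  have atom: "atom j \<in> order_interval a b" if "j \<in> ?T" for j
    unfolding atom_def using assms that by (intro order_interval_restrict) auto
  have coatom: "coatom j j' \<in> order_interval a b" if "j \<in> ?T" "j' \<in> ?T" "j \<noteq> j'" for j j'
    unfolding coatom_def using assms that by (intro order_interval_restrict) auto
  have disjoint_atoms: "r i (atom j) < l i (atom j') \<or> r i (atom j') < l i (atom j)"
    if "j \<in> ?T" "j' \<in> ?T" "j \<noteq> j'" for j j'
    using incomparable_separated[OF atom[OF that(1)] atom[OF that(2)], of j' j] that pqs
    by (auto simp: sep atom_def)
  have disjoint_coatom: "r i (atom j) < l i (coatom j' j'') \<or> r i (coatom j' j'') < l i (atom j)"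
    if "j \<in> ?T" "j' \<in> ?T" "j'' \<in> ?T" "j \<noteq> j'" "j \<noteq> j''" "j' \<noteq> j''" for j j' j''
    using incomparable_separated[OF atom[OF that(1)] coatom[OF that(2,3,6)], of j' j] that pqs
    by (auto simp: sep atom_def coatom_def)
  have meet: "l i (atom j) \<le> r i (coatom j' j'') \<and> l i (coatom j' j'') \<le> r i (atom j)"
    if "j' \<in> ?T" "j'' \<in> ?T" "j' \<noteq> j''" "j = j' \<or> j = j''" for j j' j''
    using comparable_imp_meet[of "atom j" "coatom j' j''" i] atom[of j] coatom[OF that(1-3)] that \<open>i < k\<close>
    by (auto simp: order_interval_def atom_def coatom_def)
  \<comment> \<open>The middle one of the three disjoint atom intervals lies between the other two, hence in
    the interval of the coatom above those two.\<close>
  show False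
    using disjoint_atoms[of p q] disjoint_atoms[of p s] disjoint_atoms[of q s]
      disjoint_coatom[of p q s] disjoint_coatom[of q p s] disjoint_coatom[of s p q]
      meet[of q s q] meet[of q s s] meet[of p s p] meet[of p s s] meet[of p q p] meet[of p q q]
      pqs nonempty[of "atom p" i] nonempty[of "atom q" i] nonempty[of "atom s" i]
      atom \<open>i < k\<close>
    by (simp add: order_interval_def) linarith
qed

section \<open>Walks through squares and cubes\<close>

lemma card_separating_pair:
  assumes "\<And>i. i \<in> {1..d} \<Longrightarrow> a i \<le> b i" "\<And>i. i \<in> {1..d} \<Longrightarrow> b i \<le> m i"
    and "p \<in> {1..d}" "q \<in> {1..d}" "p \<noteq> q" "a p + n \<le> b p" "a q + n \<le> b q"
  shows "n \<le> card (separating a b)"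
  using assms
proof (induction n arbitrary: a)
  case (Suc n)
  \<comment> \<open>The far corner of the lowest square on a diagonal walk of \<open>Suc n\<close>
    squares.\<close>
  let ?c = "a(p := Suc (a p), q := Suc (a q))"
  have c: "a i \<le> ?c i" "?c i \<le> b i" if "i \<in> {1..d}" for i
    using Suc.prems that by auto
  have m: "?c i \<le> m i" if "i \<in> {1..d}" for i
    using c(2) Suc.prems(2) that order_trans by blast
  have "1 \<le> card (separating a ?c)"
    by (rule card_separating_square[of _ _ p q]) (use Suc.prems c(1) m in auto)
  moreover have "n \<le> card (separating ?c b)"
    by (rule Suc.IH) (use Suc.prems c in auto)
  moreover have "card (separating a ?c) + card (separating ?c b) \<le> card (separating a b)"
    by (rule card_separating_superadditive) (use c in auto)
  ultimately show ?case by linarith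
qed simp

text \<open>The walk takes \<open>n\<close> cubes worth 2 each, then \<open>n' - n\<close> squares
  in directions \<open>q\<close>, \<open>s\<close> worth 1 each.\<close>

lemma card_separating_triple:
  assumes "\<And>i. i \<in> {1..d} \<Longrightarrow> a i \<le> b i" "\<And>i. i \<in> {1..d} \<Longrightarrow> b i \<le> m i"
    and "p \<in> {1..d}" "q \<in> {1..d}" "s \<in> {1..d}" "p \<noteq> q" "p \<noteq> s" "q \<noteq> s"
    and "n \<le> n'" "a p + n \<le> b p" "a q + n' \<le> b q" "a s + n' \<le> b s"
  shows "n + n' \<le> card (separating a b)"
  using assms
proof (induction n arbitrary: a n')
  case 0
  then show ?case
    using card_separating_pair[of a b q s n'] by simp
next
  case (Suc n)
  let ?c = "a(p := Suc (a p), q := Suc (a q), s := Suc (a s))"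
  obtain n'' where n'': "n' = Suc n''"
    using Suc.prems by (cases n') auto
  have c: "a i \<le> ?c i" "?c i \<le> b i" if "i \<in> {1..d}" for i
    using Suc.prems that by auto
  have m: "?c i \<le> m i" if "i \<in> {1..d}" for i
    using c(2) Suc.prems(2) that order_trans by blast
  have "2 \<le> card (separating a ?c)"
    by (rule card_separating_cube[of _ _ p q s]) (use Suc.prems c(1) m in auto)
  moreover have "n + n'' \<le> card (separating ?c b)"
    by (rule Suc.IH) (use Suc.prems c n'' in auto)
  moreover have "card (separating a ?c) + card (separating ?c b) \<le> card (separating a b)"
    by (rule card_separating_superadditive) (use c in auto)
  ultimately show ?case using n'' by linarith
qed

text \<open>Stage \<open>j\<close> raises coordinates \<open>s + 2 * j + 1\<close> and
  \<open>s + 2 * j + 2\<close> from 0 to \<open>m\<close>; by monotonicity the first of them bounds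
  the number of squares. The first \<open>s\<close> coordinates are raised without being
  counted.\<close>

lemma card_separating_pairs:
  assumes mono: "\<And>i. \<lbrakk>1 \<le> i; i < d\<rbrakk> \<Longrightarrow> m i \<le> m (Suc i)" and "s + 2 * t \<le> d"
  shows "(\<Sum>j<t. m (s + 2 * j + 1)) \<le>
    card (separating (\<lambda>_. 0) (\<lambda>i. if i \<le> s + 2 * t then m i else 0))"
  using assms(2)
proof (induction t)
  case (Suc t)
  let ?c = "\<lambda>t i. if i \<le> s + 2 * t then m i else 0"
  have "m (s + 2 * t + 1) \<le> card (separating (?c t) (?c (Suc t)))"
    by (rule card_separating_pair[of _ _ "s + 2 * t + 1" "s + 2 * t + 2"])
      (use Suc.prems mono[of "s + 2 * t + 1"] in auto)
  moreover have "card (separating (\<lambda>_. 0) (?c t)) + card (separating (?c t) (?c (Suc t)))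
      \<le> card (separating (\<lambda>_. 0) (?c (Suc t)))"
    by (rule card_separating_superadditive) auto
  ultimately show ?case
    using Suc by simp
qed simp

text \<open>After \<open>t\<close> pairs three coordinates remain. Their cubes and squares
  contribute \<open>m (d - 2) + m (d - 1)\<close>, and \<open>m (d - 2)\<close> is the summand
  \<open>j = t\<close>.\<close>

lemma pairs_triple_le:
  assumes mono: "\<And>i. \<lbrakk>1 \<le> i; i < d\<rbrakk> \<Longrightarrow> m i \<le> m (Suc i)" and d: "d = s + 2 * t + 3"
  shows "(\<Sum>j\<le>t. m (s + 2 * j + 1)) + m (d - 1) \<le> k"
proof -
  let ?c = "\<lambda>i. if i \<le> s + 2 * t then m i else 0"
  have "m (s + 2 * t + 1) + m (s + 2 * t + 2) \<le> card (separating ?c m)"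
    by (rule card_separating_triple[of _ _ "s + 2 * t + 1" "s + 2 * t + 2" "s + 2 * t + 3"])
      (use d mono[of "s + 2 * t + 1"] mono[of "s + 2 * t + 2"] in \<open>auto simp: numeral_3_eq_3\<close>)
  moreover have "(\<Sum>j<t. m (s + 2 * j + 1)) \<le> card (separating (\<lambda>_. 0) ?c)"
    using card_separating_pairs[OF mono] d by simp
  moreover have "card (separating (\<lambda>_. 0) ?c) + card (separating ?c m) \<le> card (separating (\<lambda>_. 0) m)"
    by (rule card_separating_superadditive) auto
  moreover have "d - 1 = s + 2 * t + 2"
    using d by simp
  ultimately show ?thesis
    using card_separating_le[of "\<lambda>_. 0" m] by (simp add: lessThan_Suc_atMost[symmetric])
qed

end

section \<open>From box representations to endpoints\<close>

lemma is_box_obtain: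
  assumes "is_box k B"
  obtains l r where "\<And>i. i < k \<Longrightarrow> l i \<le> r i" "B = (\<Pi>\<^sub>E i\<in>{..<k}. {l i..r i})"
proof -
  obtain I where I: "\<forall>i<k. \<exists>a b. a \<le> b \<and> I i = {a..b}" and B: "B = (\<Pi>\<^sub>E i\<in>{..<k}. I i)"
    using assms unfolding is_box_def by blast
  from I obtain l r where lr: "\<forall>i<k. l i \<le> r i \<and> I i = {l i..r i}"
    by metis
  then have "B = (\<Pi>\<^sub>E i\<in>{..<k}. {l i..r i})"
    unfolding B by (intro PiE_cong) auto
  with lr show ?thesis by (intro that) auto
qed

lemma box_rep_TCC_intervals:
  assumes "box_rep k (TCC d m) f"
  obtains l r where "TCC_intervals d m k l r"
proof -
  let ?V = "pverts (TCC d m)"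
  have "\<exists>l r. (\<forall>i<k. l i \<le> r i) \<and> f v = (\<Pi>\<^sub>E i\<in>{..<k}. {l i..r i})" if "v \<in> ?V" for v
    using assms that is_box_obtain unfolding box_rep_def by metis
  then obtain l r where lr: "\<And>v i. v \<in> ?V \<Longrightarrow> i < k \<Longrightarrow> l v i \<le> r v i"
    and f: "\<And>v. v \<in> ?V \<Longrightarrow> f v = (\<Pi>\<^sub>E i\<in>{..<k}. {l v i..r v i})"
    by metis
  have meet: "f x \<inter> f y \<noteq> {} \<longleftrightarrow> (\<forall>i<k. l x i \<le> r y i \<and> l y i \<le> r x i)"
    if "x \<in> ?V" "y \<in> ?V" for x y
  proof -
    have "f x \<inter> f y \<noteq> {} \<longleftrightarrow> (\<forall>i<k. {l x i..r x i} \<inter> {l y i..r y i} \<noteq> {})"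
      unfolding f[OF that(1)] f[OF that(2)] PiE_Int PiE_eq_empty_iff by auto
    \<comment> \<open>Intervals meet iff both left ends are at most both right ends; two of these
      four inequalities are nonemptiness.\<close>
    also have "\<dots> \<longleftrightarrow> (\<forall>i<k. l x i \<le> r y i \<and> l y i \<le> r x i)"
      using lr that by (auto simp: Int_atLeastAtMost)
    finally show ?thesis .
  qed
  have "TCC_intervals d m k (\<lambda>i v. l v i) (\<lambda>i v. r v i)"
  proof
    fix x y assume "x \<in> ?V" "y \<in> ?V" "x \<noteq> y"
    then show "(x, y) \<in> parcs (TCC d m) \<longleftrightarrow> (\<forall>i<k. l x i \<le> r y i \<and> l y i \<le> r x i)"
      using assms meet unfolding box_rep_def intersection_rep_def by blast
  qed (use lr in auto)
  then show ?thesis by (rule that)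
qed

text \<open>Since some representation exists, the \<open>LEAST\<close> is attained, and bounds on
  \<open>k\<close> become bounds on the boxicity.\<close>

lemma boxicity_TCC_intervals:
  obtains l r where "TCC_intervals d m (boxicity (TCC d m)) l r"
proof -
  have "\<exists>f. box_rep (boxicity (TCC d m)) (TCC d m) f"
    unfolding boxicity_def by (rule LeastI_ex) (rule box_rep_exists[OF pair_graph_TCC])
  then show ?thesis
    using box_rep_TCC_intervals that by blast
qed

lemma boxicity_le_cubicity:
  assumes "pair_graph G"
  shows "boxicity G \<le> cubicity G"
proof -
  have "\<exists>f. cube_rep (cubicity G) G f"
    unfolding cubicity_def by (rule LeastI_ex) (rule cube_rep_exists[OF assms])
  then show ?thesis
    unfolding boxicity_def using cube_rep_imp_box_rep by (blast intro: Least_le)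
qed

theorem theorem2:
  fixes d :: nat and m :: "nat \<Rightarrow> nat"
  assumes "d \<ge> 2"
    and "\<forall>i\<in>{1..d}. m i \<ge> 1"
    and "\<forall>i\<in>{1..<d}. m i \<le> m (i + 1)"
  shows
    "(d = 2 \<longrightarrow>
        cubicity (TCC d m) \<ge> boxicity (TCC d m) \<and>
        boxicity (TCC d m) \<ge> m 1) \<and>
     (d \<ge> 3 \<longrightarrow>
        cubicity (TCC d m) \<ge> boxicity (TCC d m) \<and>
        (odd d \<longrightarrow>
           boxicity (TCC d m) \<ge> (\<Sum>i | i \<in> {1..d - 2} \<and> odd i. m i) + m (d - 1)) \<and>
        (even d \<longrightarrow>
           boxicity (TCC d m) \<ge> (\<Sum>i | i \<in> {2..d - 2} \<and> even i. m i) + m (d - 1)))"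
proof -
  obtain l r where "TCC_intervals d m (boxicity (TCC d m)) l r"
    by (rule boxicity_TCC_intervals)
  then interpret TCC_intervals d m "boxicity (TCC d m)" l r .
  have mono: "m i \<le> m (Suc i)" if "1 \<le> i" "i < d" for i
    using assms that by simp
  have "m 1 \<le> boxicity (TCC d m)" if "d = 2"
    \<comment> \<open>One pair and no offset: the sum is just \<open>m 1\<close>.\<close>
    using card_separating_pairs[of 0 1, OF mono] card_separating_le order_trans that by fastforce
  moreover have "(\<Sum>i | i \<in> {1..d - 2} \<and> odd i. m i) + m (d - 1) \<le> boxicity (TCC d m)"
    if "3 \<le> d" "odd d"
  proof -
    \<comment> \<open>For odd \<open>d\<close> the offset is 0, and the last index
      \<open>2 * t + 1\<close> is \<open>d - 2\<close>.\<close>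
    define t where "t = (d - 3) div 2"
    have t: "d = 0 + 2 * t + 3"
      using that unfolding t_def by presburger
    have "(\<Sum>i | i \<in> {1..d - 2} \<and> odd i. m i) = (\<Sum>j\<le>t. m (0 + 2 * j + 1))"
      by (rule sum.reindex_bij_witness[of _ "\<lambda>j. 2 * j + 1" "\<lambda>i. i div 2"]) (use t in auto)
    then show ?thesis
      using pairs_triple_le[OF mono t] by simp
  qed
  moreover have "(\<Sum>i | i \<in> {2..d - 2} \<and> even i. m i) + m (d - 1) \<le> boxicity (TCC d m)"
    if "3 \<le> d" "even d"
  proof -
    \<comment> \<open>An even \<open>d\<close> is at least 4 here, so the subtraction is exact;
      offset 1 shifts the sum to even indices.\<close>
    define t where "t = (d - 4) div 2"
    have t: "d = 1 + 2 * t + 3"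
      using that unfolding t_def by presburger
    have "(\<Sum>i | i \<in> {2..d - 2} \<and> even i. m i) = (\<Sum>j\<le>t. m (1 + 2 * j + 1))"
      by (rule sum.reindex_bij_witness[of _ "\<lambda>j. 2 * j + 2" "\<lambda>i. i div 2 - 1"])
        (use t in \<open>auto elim!: evenE intro!: arg_cong[of _ _ m]\<close>)
    then show ?thesis
      using pairs_triple_le[OF mono t] by simp
  qed
  ultimately show ?thesis
    using boxicity_le_cubicity[OF pair_graph_TCC] by blast
qed

end
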